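(* Let $m, n \geq 1$ be integers. Let $K \subseteq [0,1]^n$ be a compact set which supports an absolutely $\alpha$-decaying, $\delta$-Ahlfors regular measure $\mu$ such that $\delta > n-1$. Then, for any real $n \times m$ matrix $A \in \mathrm{Mat}_{n \times m}(\mathbb{R})$, $$\dim (\mathbf{Bad}_A \cap K) = \delta .$$
   Context: $\dim$ denotes Hausdorff dimension. For a vector $\mathbf{v} \in \mathbb{R}^k$, $|\mathbf{v}|$ denotes the maximum of the absolute values of its coordinates, and $\|\mathbf{v}\| := \min_{\mathbf{y} \in \mathbb{Z}^k} |\mathbf{v} - \mathbf{y}|$. For an $n \times m$ real matrix $A$, $$\mathbf{Bad}_A := \left\{ \mathbf{x} \in [0,1)^n : \exists\, c(\mathbf{x}) > 0 \text{ such that } \|A\mathbf{q} - \mathbf{x}\| \geq \frac{c(\mathbf{x})}{|\mathbf{q}|^{m/n}} \ \text{ for all } \mathbf{q} \in \mathbb{Z}^m \setminus \{\mathbf{0}\} \right\}.$$ The measure $\mu$ is a non-zero, non-atomic, finite Borel measure supported on $K$. $\mathbb{R}^n$ carries the Euclidean metric, and $B(c,r)$ denotes the closed ball in $\mathbb{R}^n$ with centre $c$ and radius $r > 0$. The measure $\mu$ is $\delta$-Ahlfors regular if there exist strictly positive constants $\delta$ and $r_0$, and constants $0 < a \leq 1 \leq b$ independent of the ball, such that for all $c \in K$ and all $0 < r < r_0$, $$a\, r^{\delta} \leq \mu(B(c,r)) \leq b\, r^{\delta} .$$ For an $(n-1)$-dimensional (affine) hyperplane $\mathcal{L} \subset \mathbb{R}^n$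 and $\epsilon > 0$, $\mathcal{L}^{(\epsilon)}$ denotes the $\epsilon$-neighbourhood of $\mathcal{L}$. The measure $\mu$ is absolutely $\alpha$-decaying if there exist strictly positive constants $C$, $\alpha$ and $r_0$ such that for any $(n-1)$-dimensional hyperplane $\mathcal{L}$, any $\epsilon > 0$, any $x \in K$ and any $0 < r < r_0$, $$\mu\big(B(x,r) \cap \mathcal{L}^{(\epsilon)}\big) \leq C \left( \frac{\epsilon}{r} \right)^{\alpha} \mu(B(x,r)) .$$ *)

theory Defs
  imports "HOL-Analysis.Analysis"
begin

section \<open>Hausdorff measure and dimension\<close>

text \<open>The convention is \<open>0\<^sup>0 = 1\<close> for nonempty sets, so that the case \<open>s = 0\<close> gives
  counting measure; note that \<open>0 powr 0 = 0\<close> in the library.\<close>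

definition hausdorff_gauge :: "real \<Rightarrow> 'a::metric_space set \<Rightarrow> ennreal" where
  "hausdorff_gauge s U =
     (if U = {} then 0 else if s = 0 then 1 else ennreal (diameter U powr s))"

text \<open>Boundedness is required explicitly because \<^const>\<open>diameter\<close> is unspecified on
  unbounded sets.\<close>

definition hausdorff_premeasure :: "real \<Rightarrow> real \<Rightarrow> 'a::metric_space set \<Rightarrow> ennreal" where
  "hausdorff_premeasure s \<rho> S =
     (INF U \<in> {U :: nat \<Rightarrow> 'a set. S \<subseteq> (\<Union>i. U i) \<and> (\<forall>i. bounded (U i) \<and> diameter (U i) \<le> \<rho>)}.
        (\<Sum>i. hausdorff_gauge s (U i)))"

definition hausdorff_measure :: "real \<Rightarrow> 'a::metric_space set \<Rightarrow> ennreal" where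
  "hausdorff_measure s S = (SUP \<rho> \<in> {0<..}. hausdorff_premeasure s \<rho> S)"

definition hausdorff_dim :: "'a::metric_space set \<Rightarrow> ereal" where
  "hausdorff_dim S = (INF s \<in> {s. 0 \<le> s \<and> hausdorff_measure s S = 0}. ereal s)"

section \<open>Badly approximable affine forms\<close>

definition int_vectors :: "(real ^ 'k) set" where
  "int_vectors = {v. \<forall>i. v $ i \<in> \<int>}"

text \<open>On \<open>real ^ 'k\<close>, \<^const>\<open>infnorm\<close> is the maximum of the absolute values of the coordinates.
  The infimum below is a minimum, see \<open>dist_int_attained\<close>.\<close>

definition dist_int :: "real ^ 'k \<Rightarrow> real" where
  "dist_int v = (INF y \<in> int_vectors. infnorm (v - y))"

lemma dist_int_attained:
  fixes v :: "real ^ 'k"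
  shows "\<exists>y \<in> int_vectors. dist_int v = infnorm (v - y)"
proof
  define y :: "real ^ 'k" where "y = (\<chi> i. of_int (round (v $ i)))"
  show y: "y \<in> int_vectors"
    by (simp add: y_def int_vectors_def)
  have le: "infnorm (v - y) \<le> infnorm (v - z)" if "z \<in> int_vectors" for z
  proof -
    have "\<bar>(v - y) $ i\<bar> \<le> infnorm (v - z)" for i
    proof -
      have "z $ i \<in> \<int>"
        using that by (simp add: int_vectors_def)
      then obtain k where k: "z $ i = of_int k"
        by (rule Ints_cases)
      have "\<bar>(v - y) $ i\<bar> \<le> \<bar>(v - z) $ i\<bar>"
        using round_diff_minimal[of "v $ i" k] by (simp add: y_def k)
      also have "\<dots> \<le> infnorm (v - z)"
        by (rule component_le_infnorm_cart)
      finally show ?thesis .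
    qed
    then show ?thesis
      unfolding infnorm_cart[of "v - y"] by (intro cSup_least) auto
  qed
  show "dist_int v = infnorm (v - y)"
    unfolding dist_int_def using y le by (intro cInf_eq_minimum) auto
qed

definition Bad :: "real ^ 'm ^ 'n \<Rightarrow> (real ^ 'n) set" where
  "Bad A = {x. (\<forall>i. 0 \<le> x $ i \<and> x $ i < 1) \<and>
     (\<exists>c > 0. \<forall>q \<in> int_vectors - {0}.
        dist_int (A *v q - x) \<ge> c / infnorm q powr (real CARD('m) / real CARD('n)))}"

section \<open>Measures\<close>

definition non_atomic :: "'a measure \<Rightarrow> bool" where
  "non_atomic \<mu> \<longleftrightarrow>
     (\<forall>E \<in> sets \<mu>. 0 < emeasure \<mu> E \<longrightarrow>
        (\<exists>F \<in> sets \<mu>. F \<subseteq> E \<and> 0 < emeasure \<mu> F \<and> emeasure \<mu> F < emeasure \<mu> E))"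

definition supported_measure :: "'a::topological_space measure \<Rightarrow> 'a set \<Rightarrow> bool" where
  "supported_measure \<mu> K \<longleftrightarrow>
     sets \<mu> = sets borel \<and> finite_measure \<mu> \<and> emeasure \<mu> UNIV \<noteq> 0 \<and> non_atomic \<mu> \<and>
     (AE x in \<mu>. x \<in> K)"

definition ahlfors_regular :: "real \<Rightarrow> 'a::metric_space measure \<Rightarrow> 'a set \<Rightarrow> bool" where
  "ahlfors_regular \<delta> \<mu> K \<longleftrightarrow>
     \<delta> > 0 \<and>
     (\<exists>r0 a b. 0 < r0 \<and> 0 < a \<and> a \<le> 1 \<and> 1 \<le> b \<and>
        (\<forall>c \<in> K. \<forall>r. 0 < r \<and> r < r0 \<longrightarrow>
           a * r powr \<delta> \<le> measure \<mu> (cball c r) \<and> measure \<mu> (cball c r) \<le> b * r powr \<delta>))"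

definition affine_hyperplane :: "'a::euclidean_space set \<Rightarrow> bool" where
  "affine_hyperplane L \<longleftrightarrow> affine L \<and> aff_dim L = int DIM('a) - 1"

definition neighbourhood :: "'a::metric_space set \<Rightarrow> real \<Rightarrow> 'a set" where
  "neighbourhood L \<epsilon> = {x. \<exists>y \<in> L. dist x y < \<epsilon>}"

definition absolutely_decaying :: "real \<Rightarrow> 'a::euclidean_space measure \<Rightarrow> 'a set \<Rightarrow> bool" where
  "absolutely_decaying \<alpha> \<mu> K \<longleftrightarrow>
     \<alpha> > 0 \<and>
     (\<exists>C r0. 0 < C \<and> 0 < r0 \<and>
        (\<forall>L \<epsilon> x r. affine_hyperplane L \<and> 0 < \<epsilon> \<and> x \<in> K \<and> 0 < r \<and> r < r0 \<longrightarrow>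
           measure \<mu> (cball x r \<inter> neighbourhood L \<epsilon>)
             \<le> C * (\<epsilon> / r) powr \<alpha> * measure \<mu> (cball x r)))"

end

theory Submission
  imports Defs
begin

text \<open>
  The upper bound holds for all of \<open>K\<close>: regularity of the measure limits the number of disjoint balls
  of radius \<open>r\<close> centred in \<open>K\<close> to the order of \<open>r powr (- \<delta>)\<close> (\<open>hausdorff_dim_le_ahlfors_regular\<close>).

  For the lower bound, being badly approximable is first reduced to avoiding one family of parallel
  strips per scale. Fix an integer \<open>R \<ge> 2\<close>. For each \<open>s\<close> let \<open>z s\<close> be an integer vector in the shell
  \<open>R ^ (s - 1) < infnorm y \<le> R ^ s\<close> for which \<open>A\<^sup>T y\<close> is closest to an integer vector. Dirichlet's theorem
  for the transposed matrix says that among \<open>z 0, ..., z t\<close> one vector brings \<open>A\<^sup>T z\<close> to within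
  \<open>2 / R powr (t * n / m)\<close> of an integer vector (\<open>lacunary_integer_directions\<close>). Now
  \<open>z \<bullet> x = (A\<^sup>T z) \<bullet> q - z \<bullet> (A q - x)\<close>, so modulo integers \<open>z \<bullet> x\<close> is small if \<open>A\<^sup>T z\<close> and \<open>A q - x\<close>
  are both very close to integer vectors. Hence if \<open>z s \<bullet> x\<close> stays at a distance of at
  least \<open>\<gamma>\<close> from the integers for all \<open>s\<close>, then \<open>A q - x\<close> cannot be too close to an integer vector, and
  choosing the scale to suit \<open>q\<close> shows that \<open>x\<close> is badly approximable (\<open>lacunary_directions_imp_Bad\<close>).

  The points \<open>x\<close> of \<open>K\<close> with this property contain a Cantor set. Since \<open>z s\<close> has size about \<open>R ^ s\<close>, a
  ball of radius \<open>\<kappa> / R ^ s\<close> meets only one of the strips in which \<open>z s \<bullet> x\<close> is too close to an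
  integer, and for \<open>\<gamma> = \<kappa> / R\<^sup>2\<close> this strip is thinner by a factor of the order of \<open>R\<close> than
  the ball. By decay it carries a small proportion of the measure of the ball, and by regularity the
  rest contains a number of well-separated points of \<open>K\<close> of order \<open>R powr \<delta>\<close>, which serve as
  centres of balls of the next level (\<open>many_separated_points_off_hyperplane\<close>).
  For \<open>t < \<delta>\<close> and large \<open>R\<close> this number exceeds \<open>R powr t\<close>.

  A nested family of balls with at least \<open>R powr t\<close> separated children at each step has a limit
  set of dimension at least \<open>t\<close> (\<open>hausdorff_dim_ge_nested_cballs\<close>). Instead of distributing a mass on it,
  the proof takes a hypothetical cheap cover and follows, from level to level, a child that is met by the
  least costly part of the cover; the limit point is then missed by the cover altogether.
\<close>

section \<open>Bounding Hausdorff dimension\<close>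

lemma hausdorff_premeasure_mono:
  assumes "S \<subseteq> T"
  shows "hausdorff_premeasure s \<rho> S \<le> hausdorff_premeasure s \<rho> T"
  unfolding hausdorff_premeasure_def
  by (rule INF_superset_mono) (use assms in auto)

lemma hausdorff_dim_mono:
  assumes "S \<subseteq> T"
  shows "hausdorff_dim S \<le> hausdorff_dim T"
proof -
  have "hausdorff_measure s S \<le> hausdorff_measure s T" for s
    unfolding hausdorff_measure_def
    by (rule SUP_mono) (use hausdorff_premeasure_mono[OF assms] in blast)
  then have "hausdorff_measure s T = 0 \<Longrightarrow> hausdorff_measure s S = 0" for s
    by (metis le_zero_eq)
  then show ?thesis
    unfolding hausdorff_dim_def by (intro INF_superset_mono) auto
qed

lemma hausdorff_dim_le_if_null:
  assumes "0 \<le> \<delta>" and "\<And>s. \<delta> < s \<Longrightarrow> hausdorff_measure s S = 0"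
  shows "hausdorff_dim S \<le> ereal \<delta>"
proof (rule ereal_le_epsilon2)
  fix e :: real assume "0 < e"
  then have "hausdorff_measure (\<delta> + e) S = 0" using assms by simp
  then have "hausdorff_dim S \<le> ereal (\<delta> + e)"
    unfolding hausdorff_dim_def using assms(1) \<open>0 < e\<close> by (intro INF_lower) auto
  then show "hausdorff_dim S \<le> ereal \<delta> + ereal e" by simp
qed

text \<open>The definition covers by sequences of sets; a finite family of balls is turned into one by
  padding with the empty set, which costs nothing.\<close>

lemma hausdorff_premeasure_le_finite_cover:
  fixes S :: "'a::metric_space set"
  assumes "finite F" and "S \<subseteq> (\<Union>f\<in>F. cball f r)" and "0 < r" and "2 * r \<le> \<rho>" and "0 < s"
  shows "hausdorff_premeasure s \<rho> S \<le> ennreal (real (card F) * (2 * r) powr s)"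
proof -
  obtain e where e: "bij_betw e {0..<card F} F"
    using ex_bij_betw_nat_finite[OF \<open>finite F\<close>] by blast
  define U where "U i = (if i < card F then cball (e i) r else {})" for i
  have diam: "diameter (cball f r) \<le> 2 * r" for f :: 'a
  proof -
    have "dist x y \<le> 2 * r" if "x \<in> cball f r" "y \<in> cball f r" for x y
      using that dist_triangle3[of x y f] by simp
    then show ?thesis
      using \<open>0 < r\<close> unfolding diameter_def by (auto intro!: cSUP_least)
  qed
  have "S \<subseteq> (\<Union>i. U i)"
  proof
    fix x assume "x \<in> S"
    then obtain f where f: "f \<in> F" "x \<in> cball f r" using assms(2) by blast
    then obtain i where "i < card F" "e i = f"
      using e unfolding bij_betw_def by (metis atLeastLessThan_iff imageE)
    then have "x \<in> U i" using f by (simp add: U_def)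
    then show "x \<in> (\<Union>i. U i)" by blast
  qed
  moreover have "bounded (U i) \<and> diameter (U i) \<le> \<rho>" for i
    using diam[of "e i"] assms(3,4) by (auto simp: U_def)
  ultimately have "hausdorff_premeasure s \<rho> S \<le> (\<Sum>i. hausdorff_gauge s (U i))"
    unfolding hausdorff_premeasure_def by (intro INF_lower) auto
  also have "\<dots> = (\<Sum>i<card F. hausdorff_gauge s (U i))"
    by (rule suminf_finite) (auto simp: U_def hausdorff_gauge_def)
  also have "\<dots> \<le> (\<Sum>i<card F. ennreal ((2 * r) powr s))"
  proof (rule sum_mono)
    fix i assume "i \<in> {..<card F}"
    then show "hausdorff_gauge s (U i) \<le> ennreal ((2 * r) powr s)"
      using \<open>0 < s\<close> diam[of "e i"] \<open>0 < r\<close>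
      by (auto simp: U_def hausdorff_gauge_def intro!: ennreal_leI powr_mono2 diameter_ge_0)
  qed
  also have "\<dots> = ennreal (real (card F) * (2 * r) powr s)"
    by (simp add: ennreal_mult' ennreal_of_nat_eq_real_of_nat)
  finally show ?thesis .
qed

text \<open>A lower bound for the total cost of a cover, obtained without constructing a measure on the
  limit set. Call the weight of a ball the total cost of the sets of the cover that meet it. If a
  ball has weight less than \<open>r powr t\<close> for the radius \<open>r\<close> of its children, then it meets only sets of
  diameter less than \<open>r\<close>, which is less than the gaps between the children. So each of these sets
  meets at most one child, and the weights of the children add up to at most the weight of the ball. As there are at least
  \<open>R powr t\<close> children, one of them has a weight that is smaller by the factor \<open>R powr t\<close>, which is
  the same bound one level further down. Iterating, the limit point of the chosen balls lies in a set of
  the cover whose cost is below every bound, which is absurd since all costs are positive.\<close>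

lemma nested_cballs_avoid_cheap_cover:
  fixes S :: "'a::complete_space set" and P :: "nat \<Rightarrow> 'a \<Rightarrow> bool"
  assumes "1 < R" and "0 < \<kappa>" and "0 < t" and "P 0 x0"
    and children: "\<And>s c. P s c \<Longrightarrow> \<exists>F. finite F \<and> R powr t \<le> real (card F) \<and>
      (\<forall>f\<in>F. P (Suc s) f \<and> cball f (\<kappa> / R ^ Suc s) \<subseteq> cball c (\<kappa> / R ^ s)) \<and>
      (\<forall>f\<in>F. \<forall>g\<in>F. f \<noteq> g \<longrightarrow> 3 * (\<kappa> / R ^ Suc s) < dist f g)"
    and limit: "\<And>xs x. (\<And>s. P s (xs s)) \<Longrightarrow> (\<And>s. x \<in> cball (xs s) (\<kappa> / R ^ s)) \<Longrightarrow> x \<in> S"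
    and cover: "S \<subseteq> (\<Union>i. U i)" and bdd: "\<And>i. bounded (U i)"
    and w: "\<And>i. 0 < w i" "\<And>i. diameter (U i) powr t \<le> w i" "summable w"
  shows "(\<kappa> / R) powr t \<le> suminf w"
proof (rule ccontr)
  assume "\<not> (\<kappa> / R) powr t \<le> suminf w"
  then have small: "suminf w < (\<kappa> / R) powr t" by simp
  define r where "r s = \<kappa> / R ^ s" for s :: nat
  have r_pos: "0 < r s" for s using \<open>1 < R\<close> \<open>0 < \<kappa>\<close> by (simp add: r_def)
  have r_Suc: "r (Suc s) powr t * R powr t = r s powr t" for s
  proof -
    have "r s = r (Suc s) * R" using \<open>1 < R\<close> by (simp add: r_def)
    then show ?thesis using r_pos[of "Suc s"] \<open>1 < R\<close> by (simp add: powr_mult)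
  qed
  define v where "v s c i = (if U i \<inter> cball c (r s) \<noteq> {} then w i else 0)" for s c i
  define W where "W s c = suminf (v s c)" for s c
  have v_nonneg: "0 \<le> v s c i" for s c i using w(1)[of i] by (simp add: v_def)
  have v_le: "v s c i \<le> w i" for s c i using w(1)[of i] by (simp add: v_def)
  have summ: "summable (v s c)" for s c
    by (rule summable_comparison_test'[OF w(3), of 0]) (use v_nonneg v_le in auto)
  have w_le_W: "w i \<le> W s c" if "U i \<inter> cball c (r s) \<noteq> {}" for s c i
    using sum_le_suminf[OF summ[of s c], of "{i}"] v_nonneg[of s c] that
    by (simp add: W_def v_def)
  define Q where "Q s c \<longleftrightarrow> P s c \<and> W s c < r (Suc s) powr t" for s c
  have step: "\<exists>f. Q (Suc s) f \<and> cball f (r (Suc s)) \<subseteq> cball c (r s)" if Q: "Q s c" for s c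
  proof -
    have "P s c" using Q by (simp add: Q_def)
    from children[OF this] obtain F where "finite F \<and> R powr t \<le> real (card F) \<and>
      (\<forall>f\<in>F. P (Suc s) f \<and> cball f (r (Suc s)) \<subseteq> cball c (r s)) \<and>
      (\<forall>f\<in>F. \<forall>g\<in>F. f \<noteq> g \<longrightarrow> 3 * r (Suc s) < dist f g)"
      unfolding r_def by (rule exE)
    then have F: "finite F" "R powr t \<le> real (card F)"
      "\<And>f. f \<in> F \<Longrightarrow> P (Suc s) f \<and> cball f (r (Suc s)) \<subseteq> cball c (r s)"
      "\<And>f g. f \<in> F \<Longrightarrow> g \<in> F \<Longrightarrow> f \<noteq> g \<Longrightarrow> 3 * r (Suc s) < dist f g"
      by simp_all
    have pointwise: "(\<Sum>f\<in>F. v (Suc s) f i) \<le> v s c i" for i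
    proof (cases "\<exists>f\<in>F. U i \<inter> cball f (r (Suc s)) \<noteq> {}")
      case False
      then have "(\<Sum>f\<in>F. v (Suc s) f i) = 0" by (simp add: v_def)
      then show ?thesis using v_nonneg by simp
    next
      case True
      then obtain f where f: "f \<in> F" "U i \<inter> cball f (r (Suc s)) \<noteq> {}" by blast
      then have meets: "U i \<inter> cball c (r s) \<noteq> {}" using F(3)[OF f(1)] by blast
      have "diameter (U i) powr t < r (Suc s) powr t"
        using w(2)[of i] w_le_W[OF meets] Q by (simp add: Q_def)
      then have diam: "diameter (U i) < r (Suc s)"
        using powr_mono2[of t "r (Suc s)" "diameter (U i)"] r_pos[of "Suc s"] \<open>0 < t\<close>
        by (meson less_eq_real_def linorder_not_less)
      have unique: "g = f" if g: "g \<in> F" "U i \<inter> cball g (r (Suc s)) \<noteq> {}" for g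
      proof (rule ccontr)
        assume "g \<noteq> f"
        then have far: "3 * r (Suc s) < dist f g" using F(4) f g by metis
        obtain x y where x: "x \<in> U i" "dist f x \<le> r (Suc s)" and y: "y \<in> U i" "dist g y \<le> r (Suc s)"
          using f g by auto
        have "dist x y \<le> diameter (U i)"
          by (rule diameter_bounded_bound[OF bdd x(1) y(1)])
        then show False
          using far diam x y dist_triangle[of f g x] dist_triangle2[of x g y] by linarith
      qed
      have "(\<Sum>g\<in>F. v (Suc s) g i) = (\<Sum>g\<in>{f}. v (Suc s) g i)"
      proof (rule sum.mono_neutral_right)
        have "v (Suc s) g i = 0" if "g \<in> F" "g \<noteq> f" for g
          using unique[of g] that unfolding v_def by presburger
        then show "\<forall>g\<in>F - {f}. v (Suc s) g i = 0" by simp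
      qed (use F(1) f(1) in simp_all)
      then show ?thesis using f meets by (simp add: v_def)
    qed
    have "(\<Sum>f\<in>F. W (Suc s) f) = (\<Sum>i. \<Sum>f\<in>F. v (Suc s) f i)"
      unfolding W_def by (rule suminf_sum[symmetric]) (rule summ)
    also have "\<dots> \<le> W s c"
      unfolding W_def by (rule suminf_le[OF pointwise summable_sum]) (use summ in auto)
    finally have total: "(\<Sum>f\<in>F. W (Suc s) f) < r (Suc s) powr t" using Q by (simp add: Q_def)
    have "\<exists>f\<in>F. W (Suc s) f < r (Suc (Suc s)) powr t"
    proof (rule ccontr)
      assume "\<not> ?thesis"
      then have "r (Suc (Suc s)) powr t * real (card F) \<le> (\<Sum>f\<in>F. W (Suc s) f)"
        using sum_bounded_below[of F "r (Suc (Suc s)) powr t" "W (Suc s)"]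
        by (simp add: mult.commute not_less)
      moreover have "r (Suc s) powr t \<le> r (Suc (Suc s)) powr t * real (card F)"
        using mult_left_mono[OF F(2), of "r (Suc (Suc s)) powr t"] r_Suc[of "Suc s"] by simp
      ultimately show False using total by simp
    qed
    then show ?thesis using F(3) unfolding Q_def by blast
  qed
  have "W 0 x0 \<le> suminf w"
    unfolding W_def by (rule suminf_le[OF v_le summ w(3)])
  then have "Q 0 x0" using small \<open>P 0 x0\<close> by (simp add: Q_def r_def)
  then obtain xs where xs: "\<And>s. Q s (xs s)" "\<And>s. cball (xs (Suc s)) (r (Suc s)) \<subseteq> cball (xs s) (r s)"
    using dependent_nat_choice[of Q "\<lambda>s c f. cball f (r (Suc s)) \<subseteq> cball c (r s)"] step by blast
  have r_lim: "r \<longlonglongrightarrow> 0"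
    unfolding r_def using LIMSEQ_divide_realpow_zero[OF \<open>1 < R\<close>] by simp
  obtain x where x: "\<And>s. x \<in> cball (xs s) (r s)"
  proof (rule decreasing_closed_nest[of "\<lambda>s. cball (xs s) (r s)"])
    show "cball (xs s) (r s) \<noteq> {}" for s using r_pos[of s] by simp
    show "cball (xs n) (r n) \<subseteq> cball (xs m) (r m)" if "m \<le> n" for m n
      using lift_Suc_antimono_le[of "\<lambda>s. cball (xs s) (r s)", OF _ that] xs(2) by simp
    show "\<exists>n. \<forall>x\<in>cball (xs n) (r n). \<forall>y\<in>cball (xs n) (r n). dist x y < e" if e: "0 < e" for e
    proof -
      obtain n where n: "r n < e / 2"
        using order_tendstoD(2)[OF r_lim, of "e / 2"] e by (auto simp: eventually_sequentially)
      have "dist x y < e" if "x \<in> cball (xs n) (r n)" "y \<in> cball (xs n) (r n)" for x y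
        using that n dist_triangle3[of x y "xs n"] by simp
      then show ?thesis by blast
    qed
  qed auto
  have "x \<in> S" using limit[of xs x] xs(1) x by (auto simp: Q_def r_def)
  then obtain i where i: "x \<in> U i" using cover by blast
  have "w i < r (Suc s) powr t" for s
  proof -
    have "w i \<le> W s (xs s)" using i x[of s] by (intro w_le_W) blast
    then show ?thesis using xs(1)[of s] by (simp add: Q_def)
  qed
  moreover have "(\<lambda>s. r (Suc s) powr t) \<longlonglongrightarrow> 0"
    using tendsto_powr'[OF LIMSEQ_Suc[OF r_lim] tendsto_const, of t] \<open>0 < t\<close> r_pos
    by (auto simp: less_imp_le)
  ultimately have "w i \<le> 0"
    by (intro LIMSEQ_le_const) (auto intro: less_imp_le)
  then show False using w(1)[of i] by simp
qed

text \<open>The infimum defining the dimension ranges over all null exponents, so every \<open>s < t\<close> has to be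
  excluded, not only \<open>t\<close> itself. For sets of diameter at most one the cost with exponent \<open>s\<close>
  dominates the cost with exponent \<open>t\<close>, so a cheap cover for \<open>s\<close> is one for \<open>t\<close>; this also takes
  care of the counting convention at \<open>s = 0\<close>.\<close>

lemma hausdorff_dim_ge_nested_cballs:
  fixes S :: "'a::complete_space set" and P :: "nat \<Rightarrow> 'a \<Rightarrow> bool"
  assumes "1 < R" and "0 < \<kappa>" and "0 < t" and "P 0 x0"
    and children: "\<And>s c. P s c \<Longrightarrow> \<exists>F. finite F \<and> R powr t \<le> real (card F) \<and>
      (\<forall>f\<in>F. P (Suc s) f \<and> cball f (\<kappa> / R ^ Suc s) \<subseteq> cball c (\<kappa> / R ^ s)) \<and>
      (\<forall>f\<in>F. \<forall>g\<in>F. f \<noteq> g \<longrightarrow> 3 * (\<kappa> / R ^ Suc s) < dist f g)"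
    and limit: "\<And>xs x. (\<And>s. P s (xs s)) \<Longrightarrow> (\<And>s. x \<in> cball (xs s) (\<kappa> / R ^ s)) \<Longrightarrow> x \<in> S"
  shows "ereal t \<le> hausdorff_dim S"
proof -
  have False if s: "0 \<le> s" "s < t" and null: "hausdorff_measure s S = 0" for s
  proof -
    define \<eta> where "\<eta> = (\<kappa> / R) powr t / 4"
    have "0 < \<eta>" using \<open>1 < R\<close> \<open>0 < \<kappa>\<close> by (simp add: \<eta>_def)
    have "hausdorff_premeasure s 1 S \<le> hausdorff_measure s S"
      unfolding hausdorff_measure_def by (rule SUP_upper) simp
    then have "hausdorff_premeasure s 1 S < ennreal \<eta>"
      using null \<open>0 < \<eta>\<close> by simp
    then obtain U where U: "S \<subseteq> (\<Union>i. U i)" "\<And>i. bounded (U i)" "\<And>i. diameter (U i) \<le> 1"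
      and cheap: "(\<Sum>i. hausdorff_gauge s (U i)) < ennreal \<eta>"
      unfolding hausdorff_premeasure_def by (auto simp: INF_less_iff)
    define d where "d i = diameter (U i) powr t" for i
    have d_nonneg: "0 \<le> d i" for i by (simp add: d_def)
    have d_le: "ennreal (d i) \<le> hausdorff_gauge s (U i)" for i
    proof (cases "U i = {}")
      case True
      then show ?thesis by (simp add: d_def hausdorff_gauge_def)
    next
      case False
      have "0 \<le> diameter (U i)" by (rule diameter_ge_0[OF U(2)])
      then have "d i \<le> 1"
        using powr_mono2[of t "diameter (U i)" 1] U(3)[of i] \<open>0 < t\<close> by (simp add: d_def)
      moreover have "d i \<le> diameter (U i) powr s"
        using powr_mono'[of s t "diameter (U i)"] U(3)[of i] \<open>0 \<le> diameter (U i)\<close> s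
        by (simp add: d_def)
      ultimately show ?thesis
        using False by (auto simp: hausdorff_gauge_def intro: ennreal_leI)
    qed
    have le: "(\<Sum>i. ennreal (d i)) \<le> (\<Sum>i. hausdorff_gauge s (U i))"
      by (rule suminf_le) (use d_le in auto)
    have fin: "(\<Sum>i. ennreal (d i)) < ennreal \<eta>" using le_less_trans[OF le cheap] .
    have "(\<Sum>i. ennreal (d i)) < top" by (rule less_trans[OF fin ennreal_less_top])
    then have summ: "summable d"
      by (intro summable_suminf_not_top d_nonneg) simp
    have d_sum: "suminf d < \<eta>"
      using fin suminf_ennreal2[OF d_nonneg summ] suminf_nonneg[OF summ d_nonneg]
      by (simp add: ennreal_less_iff)
    \<comment> \<open>A set of diameter zero has cost zero; the extra summand gives every set of the cover a
      positive cost, so that no set can meet all balls of the nested sequence.\<close>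
    define w where "w i = d i + \<eta> * (1 / 2) ^ i" for i
    have geo: "(\<lambda>i. \<eta> * (1 / 2) ^ i) sums (\<eta> * 2)"
      using geometric_sums[of "1 / 2 :: real"] by (intro sums_mult) simp
    have "w sums (suminf d + \<eta> * 2)"
      unfolding w_def by (rule sums_add[OF summable_sums[OF summ] geo])
    then have w: "summable w" "suminf w = suminf d + \<eta> * 2"
      by (auto simp: sums_iff)
    have "(\<kappa> / R) powr t \<le> suminf w"
    proof (rule nested_cballs_avoid_cheap_cover[of R \<kappa> t P x0 S U w])
      show "0 < w i" for i using d_nonneg[of i] \<open>0 < \<eta>\<close> by (simp add: w_def add_nonneg_pos)
      show "diameter (U i) powr t \<le> w i" for i using \<open>0 < \<eta>\<close> by (simp add: w_def d_def)
    qed (fact assms U w)+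
    moreover have "(\<kappa> / R) powr t = 4 * \<eta>" by (simp add: \<eta>_def)
    ultimately show False using w(2) d_sum \<open>0 < \<eta>\<close> by linarith
  qed
  then show ?thesis
    unfolding hausdorff_dim_def by (intro INF_greatest) (force simp: not_less[symmetric])
qed

section \<open>Separated sets\<close>

text \<open>A maximal separated set is automatically a net. Maximal ones exist because a finite
  \<open>e / 2\<close>-net of the compact superset bounds the cardinality of all \<open>e\<close>-separated sets.\<close>

lemma maximal_separated_set:
  fixes X :: "'a::metric_space set"
  assumes "compact K" and "X \<subseteq> K" and "0 < e"
  obtains D where "finite D" and "D \<subseteq> X" and "\<And>x y. x \<in> D \<Longrightarrow> y \<in> D \<Longrightarrow> x \<noteq> y \<Longrightarrow> e < dist x y"
    and "X \<subseteq> (\<Union>d\<in>D. cball d e)"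
proof -
  obtain k where k: "finite k" "K \<subseteq> (\<Union>x\<in>k. ball x (e / 2))"
    using assms(1,3) unfolding compact_eq_totally_bounded by (meson half_gt_zero)
  define sep where "sep D \<longleftrightarrow> D \<subseteq> X \<and> (\<forall>x\<in>D. \<forall>y\<in>D. x \<noteq> y \<longrightarrow> e < dist x y)" for D
  have bound: "finite D \<and> card D \<le> card k" if D: "sep D" for D
  proof -
    have "\<exists>p\<in>k. dist p x < e / 2" if "x \<in> D" for x
    proof -
      have "x \<in> (\<Union>p\<in>k. ball p (e / 2))" using D that k(2) assms(2) unfolding sep_def by blast
      then show ?thesis by auto
    qed
    then obtain h where h: "\<And>x. x \<in> D \<Longrightarrow> h x \<in> k \<and> dist (h x) x < e / 2" by metis
    have "inj_on h D"
    proof (rule inj_onI, rule ccontr)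
      fix x y assume xy: "x \<in> D" "y \<in> D" "h x = h y" "x \<noteq> y"
      then have "e < dist x y" using D by (auto simp: sep_def)
      then show False using h[OF xy(1)] h[OF xy(2)] xy(3) dist_triangle3[of x y "h x"] by simp
    qed
    then show ?thesis using h k(1) by (meson card_inj_on_le image_subsetI inj_on_finite)
  qed
  have "sep {}" by (simp add: sep_def)
  then obtain D where D: "sep D" "\<And>D'. sep D' \<Longrightarrow> card D' \<le> card D"
    using ex_has_greatest_nat[of sep "{}" card "Suc (card k)"] bound less_Suc_eq_le by blast
  have "X \<subseteq> (\<Union>d\<in>D. cball d e)"
  proof (rule ccontr)
    assume "\<not> X \<subseteq> (\<Union>d\<in>D. cball d e)"
    then obtain x where "x \<in> X" "\<And>d. d \<in> D \<Longrightarrow> x \<notin> cball d e" by blast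
    then have x: "x \<in> X" "\<And>d. d \<in> D \<Longrightarrow> e < dist d x" by (auto simp: not_le)
    then have "sep (insert x D)" using D(1) by (auto simp: sep_def dist_commute)
    moreover have "x \<notin> D" using x(2)[of x] assms(3) by auto
    ultimately show False using D(2)[of "insert x D"] bound[OF D(1)] by simp
  qed
  then show thesis using that[of D] D(1) bound[OF D(1)] by (auto simp: sep_def)
qed

section \<open>Integer points and Dirichlet's theorem\<close>

lemma dist_int_le:
  assumes "y \<in> int_vectors"
  shows "dist_int v \<le> infnorm (v - y)"
  unfolding dist_int_def
  by (rule cINF_lower[OF _ assms]) (auto intro!: bdd_belowI2[of _ 0] infnorm_pos_le)

lemma infnorm_cart_le:
  fixes v :: "real ^ 'k"
  assumes "\<And>i. \<bar>v $ i\<bar> \<le> B"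
  shows "infnorm v \<le> B"
  unfolding infnorm_cart by (rule cSup_least) (use assms in auto)

lemma infnorm_cart_attained:
  fixes v :: "real ^ 'k"
  shows "\<exists>i. infnorm v = \<bar>v $ i\<bar>"
proof -
  have "infnorm v = Max (range (\<lambda>i. \<bar>v $ i\<bar>))"
    unfolding infnorm_cart by (subst cSup_eq_Max) (auto simp: full_SetCompr_eq)
  also have "\<dots> \<in> range (\<lambda>i. \<bar>v $ i\<bar>)" by (rule Max_in) auto
  finally show ?thesis by (rule rangeE) blast
qed

lemma infnorm_int_vector_ge_1:
  assumes "q \<in> int_vectors" and "q \<noteq> (0 :: real ^ 'k)"
  shows "1 \<le> infnorm q"
proof -
  obtain i where "q $ i \<noteq> 0" using assms(2) by (auto simp: vec_eq_iff)
  moreover have "q $ i \<in> \<int>" using assms(1) by (simp add: int_vectors_def)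
  ultimately have "1 \<le> \<bar>q $ i\<bar>" using Ints_nonzero_abs_ge1 by blast
  then show ?thesis using component_le_infnorm_cart[of q i] by simp
qed

lemma abs_inner_le_infnorm:
  fixes u v :: "real ^ 'k"
  shows "\<bar>u \<bullet> v\<bar> \<le> real CARD('k) * infnorm u * infnorm v"
proof -
  have "\<bar>u \<bullet> v\<bar> \<le> (\<Sum>i\<in>UNIV. \<bar>u $ i * v $ i\<bar>)"
    unfolding inner_vec_def by (simp add: sum_abs)
  also have "\<dots> \<le> (\<Sum>i\<in>(UNIV::'k set). infnorm u * infnorm v)"
    by (rule sum_mono)
      (auto simp: abs_mult component_le_infnorm_cart infnorm_pos_le intro!: mult_mono)
  finally show ?thesis by simp
qed

lemma inner_int_vectors:
  assumes "u \<in> int_vectors" and "v \<in> int_vectors"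
  shows "u \<bullet> v \<in> \<int>"
  using assms by (auto simp: inner_vec_def int_vectors_def intro!: Ints_sum Ints_mult)

lemma finite_int_vectors_bounded:
  "finite {y \<in> int_vectors. infnorm (y :: real ^ 'k) \<le> B}"
proof -
  define G where "G = (\<lambda>g. \<chi> i. real_of_int (g i)) ` PiE (UNIV :: 'k set) (\<lambda>_. {- \<lfloor>B\<rfloor>..\<lfloor>B\<rfloor>})"
  have "y \<in> G" if y: "y \<in> int_vectors" "infnorm y \<le> B" for y :: "real ^ 'k"
  proof -
    define g where "g i = \<lfloor>y $ i\<rfloor>" for i
    have gi: "y $ i = real_of_int (g i)" for i
      using y(1) by (simp add: int_vectors_def g_def of_int_floor)
    have "g i \<in> {- \<lfloor>B\<rfloor>..\<lfloor>B\<rfloor>}" for i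
    proof -
      have "real_of_int \<bar>g i\<bar> \<le> B"
        using component_le_infnorm_cart[of y i] y(2) gi[of i] by simp
      then have "\<bar>g i\<bar> \<le> \<lfloor>B\<rfloor>" by (simp add: le_floor_iff)
      then show ?thesis by auto
    qed
    moreover have "y = (\<chi> i. real_of_int (g i))" using gi by (simp add: vec_eq_iff)
    ultimately show ?thesis unfolding G_def by blast
  qed
  moreover have "finite G" unfolding G_def by (intro finite_imageI finite_PiE) auto
  ultimately show ?thesis by (metis (no_types, lifting) finite_subset mem_Collect_eq subsetI)
qed

text \<open>The pigeonhole principle: the \<open>(Q + 1) ^ n\<close> integer points of the cube \<open>[0, Q] ^ n\<close> are sorted
  into \<open>N ^ m\<close> boxes of the unit cube according to the fractional parts of their images under \<open>B\<close>,
  where \<open>N\<close> is the integer part of \<open>Q powr (n / m)\<close>. The difference of two points in the same box is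
  the vector looked for.\<close>

lemma dirichlet_linear_forms:
  fixes B :: "real ^ 'n ^ 'm" and Q :: nat
  assumes "1 \<le> Q"
  shows "\<exists>y \<in> int_vectors - {0}. infnorm y \<le> real Q \<and>
    dist_int (B *v y) \<le> 2 / real Q powr (real CARD('n) / real CARD('m))"
proof -
  define X where "X = real Q powr (real CARD('n) / real CARD('m))"
  have X1: "1 \<le> X" unfolding X_def using assms by (intro ge_one_powr_ge_zero) auto
  define N where "N = nat \<lfloor>X\<rfloor>"
  have N: "1 \<le> N" "real N \<le> X" "X < real N + 1"
    using X1 unfolding N_def by (auto simp: le_nat_iff le_floor_iff)
  define vec where "vec g = (\<chi> i. real (g i))" for g :: "'n \<Rightarrow> nat"
  define box where "box g = (\<lambda>j. nat \<lfloor>real N * frac ((B *v vec g) $ j)\<rfloor>)" for g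
  define D where "D = PiE (UNIV :: 'n set) (\<lambda>_. {0..Q})"
  define T where "T = PiE (UNIV :: 'm set) (\<lambda>_. {0..<N})"
  have T: "finite T" "card T = N ^ CARD('m)"
    unfolding T_def by (simp_all add: finite_PiE card_PiE)
  have D: "card D = (Q + 1) ^ CARD('n)" unfolding D_def by (simp add: card_PiE)
  have box_T: "box g \<in> T" for g
  proof -
    have "real N * frac a < real N" for a using frac_lt_1[of a] N(1) by simp
    then have "nat \<lfloor>real N * frac a\<rfloor> < N" for a
      using N(1) by (simp add: nat_less_iff floor_less_iff)
    then show ?thesis unfolding T_def box_def by auto
  qed
  have "real (card T) \<le> X ^ CARD('m)" using T N(2) by (simp add: power_mono)
  also have "\<dots> = real Q ^ CARD('n)"
    using assms by (simp add: X_def powr_power powr_realpow)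
  also have "\<dots> < real (card D)" unfolding D by (simp add: power_strict_mono)
  finally have "card T < card D" by simp
  moreover have "card (box ` D) \<le> card T"
    using box_T T(1) by (intro card_mono) auto
  ultimately have "\<not> inj_on box D" by (intro pigeonhole) simp
  then obtain g h where gh: "g \<in> D" "h \<in> D" "g \<noteq> h" "box g = box h" by (auto simp: inj_on_def)
  define y where "y = vec g - vec h"
  have yi: "y $ i = real (g i) - real (h i)" for i by (simp add: y_def vec_def)
  have "y \<in> int_vectors" by (simp add: int_vectors_def yi)
  moreover have "y \<noteq> 0" using gh(3) by (auto simp: vec_eq_iff yi)
  moreover have "infnorm y \<le> real Q"
  proof (rule infnorm_cart_le)
    fix i
    have "g i \<le> Q" "h i \<le> Q" using gh(1,2) by (auto simp: D_def)
    then show "\<bar>y $ i\<bar> \<le> real Q" by (simp add: yi)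
  qed
  moreover have "dist_int (B *v y) \<le> 2 / X"
  proof -
    define p where "p = (\<chi> j. real_of_int (\<lfloor>(B *v vec g) $ j\<rfloor> - \<lfloor>(B *v vec h) $ j\<rfloor>))"
    have "p \<in> int_vectors" by (simp add: p_def int_vectors_def)
    then have "dist_int (B *v y) \<le> infnorm (B *v y - p)" by (rule dist_int_le)
    also have "\<dots> \<le> 1 / real N"
    proof (rule infnorm_cart_le)
      fix j
      define a where "a = frac ((B *v vec g) $ j)"
      define b where "b = frac ((B *v vec h) $ j)"
      have "nat \<lfloor>real N * a\<rfloor> = nat \<lfloor>real N * b\<rfloor>"
        using fun_cong[OF gh(4), of j] by (simp add: box_def a_def b_def)
      then have "\<lfloor>real N * a\<rfloor> = \<lfloor>real N * b\<rfloor>"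
        by (subst (asm) eq_nat_nat_iff) (auto simp: a_def b_def)
      then have "\<bar>real N * a - real N * b\<bar> < 1" by linarith
      then have "real N * \<bar>a - b\<bar> < 1"
        by (simp add: right_diff_distrib[symmetric] abs_mult)
      then have "\<bar>a - b\<bar> \<le> 1 / real N" using N(1) by (simp add: field_simps)
      moreover have "(B *v y - p) $ j = a - b"
        by (simp add: y_def p_def a_def b_def frac_def matrix_vector_mult_diff_distrib)
      ultimately show "\<bar>(B *v y - p) $ j\<bar> \<le> 1 / real N" by simp
    qed
    also have "\<dots> \<le> 2 / X"
    proof -
      have "1 \<le> real N" using N(1) by simp
      then have "X \<le> 2 * real N" using N(3) by linarith
      then show ?thesis using \<open>1 \<le> real N\<close> X1 by (simp add: field_simps)
    qed
    finally show ?thesis .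
  qed
  ultimately show ?thesis unfolding X_def by blast
qed

section \<open>Transference\<close>

text \<open>Write \<open>z \<bullet> x = (A\<^sup>T z) \<bullet> q - z \<bullet> (A q - x)\<close> and replace \<open>A\<^sup>T z\<close> and \<open>A q - x\<close> by their differences to
  the nearest integer vectors; this changes the right-hand side by an integer.\<close>

lemma transference:
  fixes A :: "real ^ 'm ^ 'n" and x z :: "real ^ 'n" and q :: "real ^ 'm"
  assumes "z \<in> int_vectors" and "q \<in> int_vectors"
    and far: "\<And>p. p \<in> \<int> \<Longrightarrow> \<gamma> \<le> \<bar>z \<bullet> x - p\<bar>"
  shows "\<gamma> \<le> real CARD('n) * infnorm z * dist_int (A *v q - x)
    + real CARD('m) * dist_int (transpose A *v z) * infnorm q"
proof -
  obtain y where y: "y \<in> int_vectors" "dist_int (A *v q - x) = infnorm (A *v q - x - y)"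
    using dist_int_attained by blast
  obtain u where u: "u \<in> int_vectors" "dist_int (transpose A *v z) = infnorm (transpose A *v z - u)"
    using dist_int_attained by blast
  have adj: "z \<bullet> (A *v q) = (transpose A *v z) \<bullet> q"
    by (simp add: dot_lmul_matrix[symmetric])
  have "u \<bullet> q - z \<bullet> y \<in> \<int>" using assms y u by (intro Ints_diff inner_int_vectors)
  then have "\<gamma> \<le> \<bar>z \<bullet> x - (u \<bullet> q - z \<bullet> y)\<bar>" by (rule far)
  also have "z \<bullet> x - (u \<bullet> q - z \<bullet> y) = (transpose A *v z - u) \<bullet> q - z \<bullet> (A *v q - x - y)"
    by (simp add: inner_diff_right inner_diff_left adj)
  also have "\<bar>\<dots>\<bar> \<le> \<bar>(transpose A *v z - u) \<bullet> q\<bar> + \<bar>z \<bullet> (A *v q - x - y)\<bar>" by (rule abs_triangle_ineq4)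
  also have "\<dots> \<le> real CARD('m) * infnorm (transpose A *v z - u) * infnorm q
      + real CARD('n) * infnorm z * infnorm (A *v q - x - y)"
    by (intro add_mono abs_inner_le_infnorm)
  finally show ?thesis using y u by simp
qed

text \<open>In each shell \<open>R ^ (s - 1) < infnorm y \<le> R ^ s\<close> the vector \<open>z s\<close> is an integer point whose
  image under the transpose is closest to an integer point. The Dirichlet vector for the bound
  \<open>R ^ t\<close> lies in one of the first shells, and the minimiser of that shell is at least as good.
  One vector per shell is what makes the sequence usable: the sets that the points of the Cantor
  construction have to avoid come one per scale.\<close>

lemma lacunary_integer_directions:
  fixes A :: "real ^ 'm ^ 'n" and R :: nat
  assumes "2 \<le> R"
  obtains z :: "nat \<Rightarrow> real ^ 'n"
  where "\<And>s. z s \<in> int_vectors" "\<And>s. real R ^ s / real R < infnorm (z s)"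
    "\<And>s. infnorm (z s) \<le> real R ^ s"
    "\<And>t. \<exists>s\<le>t. dist_int (transpose A *v z s)
      \<le> 2 / (real R ^ t) powr (real CARD('n) / real CARD('m))"
proof -
  define E :: "nat \<Rightarrow> (real ^ 'n) set"
    where "E s = {y \<in> int_vectors. real R ^ s / real R < infnorm y \<and> infnorm y \<le> real R ^ s}" for s
  have fin: "finite (E s)" for s
    by (rule finite_subset[OF _ finite_int_vectors_bounded[of "real R ^ s"]]) (auto simp: E_def)
  have ne: "E s \<noteq> {}" for s
  proof -
    define e :: "real ^ 'n" where "e = (\<chi> i. real R ^ s)"
    have "e \<in> int_vectors" by (simp add: e_def int_vectors_def)
    moreover have "infnorm e = real R ^ s"
      using infnorm_cart_attained[of e] by (auto simp: e_def)
    moreover have "real R ^ s / real R < real R ^ s" using assms by (simp add: field_simps)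
    ultimately have "e \<in> E s" by (simp add: E_def)
    then show ?thesis by blast
  qed
  have "\<exists>y. y \<in> E s \<and> (\<forall>y'\<in>E s. dist_int (transpose A *v y) \<le> dist_int (transpose A *v y'))" for s
    using ex_is_arg_min_if_finite[OF fin ne, of "\<lambda>y. dist_int (transpose A *v y)" s]
    by (auto simp: is_arg_min_linorder)
  then obtain z where z: "\<And>s. z s \<in> E s"
    "\<And>s y. y \<in> E s \<Longrightarrow> dist_int (transpose A *v z s) \<le> dist_int (transpose A *v y)"
    by metis
  show thesis
  proof (rule that[of z])
    show "z s \<in> int_vectors" "real R ^ s / real R < infnorm (z s)" "infnorm (z s) \<le> real R ^ s" for s
      using z(1)[of s] by (auto simp: E_def)
    fix t
    obtain y where y: "y \<in> int_vectors" "y \<noteq> 0" "infnorm y \<le> real R ^ t"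
      "dist_int (transpose A *v y) \<le> 2 / (real R ^ t) powr (real CARD('n) / real CARD('m))"
      using dirichlet_linear_forms[of "R ^ t" "transpose A"] assms by auto
    define s where "s = (LEAST s. infnorm y \<le> real R ^ s)"
    have s: "infnorm y \<le> real R ^ s" "s \<le> t"
      unfolding s_def using y(3) by (auto intro: LeastI Least_le)
    have "real R ^ s / real R < infnorm y"
    proof (cases s)
      case 0
      have "1 / real R < 1" using assms by simp
      then show ?thesis using infnorm_int_vector_ge_1[OF y(1,2)] 0 by simp
    next
      case (Suc s')
      then have "\<not> infnorm y \<le> real R ^ s'"
        using not_less_Least[of s' "\<lambda>s. infnorm y \<le> real R ^ s"] by (simp add: s_def)
      then show ?thesis using Suc assms by simp
    qed
    then have "y \<in> E s" using s y by (simp add: E_def)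
    then show "\<exists>s\<le>t. dist_int (transpose A *v z s)
      \<le> 2 / (real R ^ t) powr (real CARD('n) / real CARD('m))"
      using z(2) y(4) s(2) order_trans by blast
  qed
qed

text \<open>Given \<open>q\<close>, choose the scale \<open>t\<close> so that the second term of the transference inequality is at most
  \<open>\<gamma> / 2\<close>. This needs \<open>R ^ t\<close> of order \<open>infnorm q powr (m / n)\<close>, and then the first term yields a lower
  bound for the distance that is of order \<open>infnorm q powr (- m / n)\<close>, as badly approximable points
  require.\<close>

lemma lacunary_directions_imp_Bad:
  fixes A :: "real ^ 'm ^ 'n" and R :: nat and z :: "nat \<Rightarrow> real ^ 'n"
  assumes "2 \<le> R" and z: "\<And>s. z s \<in> int_vectors" "\<And>s. infnorm (z s) \<le> real R ^ s"
    and small: "\<And>t. \<exists>s\<le>t. dist_int (transpose A *v z s)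
      \<le> 2 / (real R ^ t) powr (real CARD('n) / real CARD('m))"
    and x: "\<And>i. 0 \<le> x $ i \<and> x $ i < 1"
    and \<gamma>: "0 < \<gamma>" "\<gamma> \<le> 1" and far: "\<And>s p. p \<in> \<int> \<Longrightarrow> \<gamma> \<le> \<bar>z s \<bullet> x - p\<bar>"
  shows "x \<in> Bad A"
proof -
  define n where "n = real CARD('n)"
  define m where "m = real CARD('m)"
  have nm: "1 \<le> n" "1 \<le> m" by (simp_all add: n_def m_def Suc_leI)
  define c where "c = \<gamma> / (2 * n * real R * (4 * m / \<gamma>) powr (m / n))"
  have "0 < c" using \<gamma> nm assms(1) by (simp add: c_def)
  have "c / infnorm q powr (m / n) \<le> dist_int (A *v q - x)" if q: "q \<in> int_vectors" "q \<noteq> 0" for q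
  proof -
    define H where "H = infnorm q"
    have H: "1 \<le> H" unfolding H_def using infnorm_int_vector_ge_1[OF q] .
    define X where "X = (4 * m * H / \<gamma>) powr (m / n)"
    have base: "1 \<le> 4 * m * H / \<gamma>"
    proof -
      have "1 * 1 \<le> m * H" using nm H by (intro mult_mono) auto
      then show ?thesis using \<gamma> by (simp add: field_simps)
    qed
    have X: "1 \<le> X" unfolding X_def using base nm by (intro ge_one_powr_ge_zero) auto
    \<comment> \<open>The scale is the first power of \<open>R\<close> above \<open>X\<close>: large enough for the error term of the
      transference inequality to be absorbed, and at most \<open>R * X\<close>.\<close>
    define t where "t = (LEAST t. X \<le> real R ^ t)"
    obtain t0 where "X < real R ^ t0" using real_arch_pow[of "real R" X] assms(1) by auto
    then have t: "X \<le> real R ^ t" unfolding t_def by (metis LeastI less_imp_le)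
    have t_le: "real R ^ t \<le> real R * X"
    proof (cases t)
      case 0
      have "1 * 1 \<le> real R * X" using assms(1) X by (intro mult_mono) auto
      then show ?thesis using 0 by simp
    next
      case (Suc t')
      then have "\<not> X \<le> real R ^ t'"
        using not_less_Least[of t' "\<lambda>t. X \<le> real R ^ t"] by (simp add: t_def)
      then show ?thesis using Suc by (simp add: mult_left_mono)
    qed
    obtain s where s: "s \<le> t" "dist_int (transpose A *v z s) \<le> 2 / (real R ^ t) powr (n / m)"
      using small[of t] unfolding n_def m_def by blast
    have "4 * m * H / \<gamma> = X powr (n / m)"
      using nm base H \<gamma> by (simp add: X_def powr_powr)
    also have "\<dots> \<le> (real R ^ t) powr (n / m)"
      using t X nm by (intro powr_mono2) auto
    finally have "2 / (real R ^ t) powr (n / m) \<le> 2 / (4 * m * H / \<gamma>)"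
      using base by (intro divide_left_mono mult_pos_pos) linarith+
    also have "\<dots> = \<gamma> / (2 * m * H)" by simp
    finally have "m * dist_int (transpose A *v z s) * H \<le> m * (\<gamma> / (2 * m * H)) * H"
      using s(2) nm H by (intro mult_right_mono mult_left_mono) auto
    also have "\<dots> = \<gamma> / 2" using nm H by simp
    finally have error: "m * dist_int (transpose A *v z s) * H \<le> \<gamma> / 2" .
    define d where "d = dist_int (A *v q - x)"
    have "0 \<le> d" unfolding d_def using dist_int_attained[of "A *v q - x"] by (auto simp: infnorm_pos_le)
    have "infnorm (z s) \<le> real R ^ t"
      using assms(1) by (intro order_trans[OF z(2)[of s] power_increasing[OF s(1)]]) simp
    then have "infnorm (z s) \<le> real R * X" using t_le by simp
    then have "n * infnorm (z s) * d \<le> n * (real R * X) * d"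
      using nm \<open>0 \<le> d\<close> by (intro mult_right_mono mult_left_mono) auto
    moreover have "\<gamma> \<le> n * infnorm (z s) * d + m * dist_int (transpose A *v z s) * H"
      unfolding n_def m_def d_def H_def by (rule transference[OF z(1) q(1) far])
    ultimately have "\<gamma> / 2 \<le> n * (real R * X) * d" using error by simp
    moreover have "0 < n * (real R * X)" using nm assms(1) X by simp
    ultimately have "\<gamma> / 2 / (n * (real R * X)) \<le> d" by (simp add: field_simps)
    moreover have "X = (4 * m / \<gamma>) powr (m / n) * H powr (m / n)"
      using nm H \<gamma> by (simp add: X_def powr_mult[symmetric])
    then have "\<gamma> / 2 / (n * (real R * X)) = c / H powr (m / n)"
      by (simp add: c_def field_simps)
    ultimately show ?thesis unfolding d_def H_def by simp
  qed
  then show ?thesis unfolding Bad_def using x \<open>0 < c\<close> by (auto simp: n_def m_def)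
qed

section \<open>Hyperplanes and separated points\<close>

lemma affine_hyperplane_inner:
  fixes z :: "'a::euclidean_space"
  assumes "z \<noteq> 0"
  shows "affine_hyperplane {x. z \<bullet> x = p}"
  using assms by (simp add: affine_hyperplane_def Affine.affine_hyperplane aff_dim_hyperplane)

lemma in_neighbourhood_hyperplane:
  fixes z x :: "'a::euclidean_space"
  assumes "\<bar>z \<bullet> x - p\<bar> < \<epsilon> * norm z" and "z \<noteq> 0"
  shows "x \<in> neighbourhood {y. z \<bullet> y = p} \<epsilon>"
proof -
  define y where "y = x - ((z \<bullet> x - p) / (z \<bullet> z)) *\<^sub>R z"
  have "z \<bullet> y = p" using assms(2) by (simp add: y_def inner_diff_right)
  moreover have "dist x y = \<bar>z \<bullet> x - p\<bar> / norm z"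
    using assms(2) by (simp add: y_def dist_norm power2_norm_eq_inner[symmetric] power2_eq_square)
  then have "dist x y < \<epsilon>" using assms by (simp add: divide_less_eq)
  ultimately show ?thesis by (auto simp: neighbourhood_def)
qed

lemma open_neighbourhood: "open (neighbourhood L \<epsilon>)"
proof -
  have "neighbourhood L \<epsilon> = (\<Union>y\<in>L. ball y \<epsilon>)" by (auto simp: neighbourhood_def dist_commute)
  then show ?thesis by auto
qed

text \<open>Balls of radius \<open>\<rho>\<close> around a maximal separated set cover the part of the ball that lies off the
  strip. By decay the strip carries at most half of the lower bound for the measure of the ball, so
  that regularity on the small balls gives the number of centres needed.\<close>

lemma many_separated_points_off_hyperplane:
  fixes K :: "'a::euclidean_space set"
  assumes "compact K" and supp: "supported_measure \<mu> K"
    and reg: "\<And>c r. c \<in> K \<Longrightarrow> 0 < r \<Longrightarrow> r < r0 \<Longrightarrow>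
      a * r powr \<delta> \<le> measure \<mu> (cball c r) \<and> measure \<mu> (cball c r) \<le> b * r powr \<delta>"
    and pos: "0 < a" "0 < b" "0 < \<rho>" "\<rho> < r0" "0 < r" "r < r0" and "c \<in> K"
    and decay: "measure \<mu> (cball c r \<inter> neighbourhood L \<epsilon>) \<le> \<theta> * measure \<mu> (cball c r)"
    and \<theta>: "0 \<le> \<theta>" "\<theta> * b \<le> a / 2"
  obtains F where "finite F" and "F \<subseteq> K \<inter> cball c r - neighbourhood L \<epsilon>"
    and "\<And>f g. f \<in> F \<Longrightarrow> g \<in> F \<Longrightarrow> f \<noteq> g \<Longrightarrow> \<rho> < dist f g"
    and "a / (2 * b) * (r / \<rho>) powr \<delta> \<le> real (card F)"
proof -
  interpret finite_measure \<mu> using supp by (simp add: supported_measure_def)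
  have sets[simp]: "sets \<mu> = sets borel" and AE: "AE x in \<mu>. x \<in> K"
    using supp by (auto simp: supported_measure_def)
  define N where "N = neighbourhood L \<epsilon>"
  have [measurable]: "N \<in> sets borel" unfolding N_def by (intro borel_open open_neighbourhood)
  have sub: "K \<inter> cball c r - N \<subseteq> K" by blast
  obtain F where F: "finite F" "F \<subseteq> K \<inter> cball c r - N"
    "\<And>f g. f \<in> F \<Longrightarrow> g \<in> F \<Longrightarrow> f \<noteq> g \<Longrightarrow> \<rho> < dist f g"
    "K \<inter> cball c r - N \<subseteq> (\<Union>f\<in>F. cball f \<rho>)"
    by (rule maximal_separated_set[OF \<open>compact K\<close> sub \<open>0 < \<rho>\<close>]) (rule that)
  have "measure \<mu> (cball c r) \<le> measure \<mu> ((cball c r \<inter> N) \<union> (\<Union>f\<in>F. cball f \<rho>))"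
  proof (rule finite_measure_mono_AE)
    show "AE x in \<mu>. x \<in> cball c r \<longrightarrow> x \<in> (cball c r \<inter> N) \<union> (\<Union>f\<in>F. cball f \<rho>)"
      using AE by eventually_elim (use F(4) in blast)
    show "(cball c r \<inter> N) \<union> (\<Union>f\<in>F. cball f \<rho>) \<in> sets \<mu>"
      unfolding sets using F(1) by (intro sets.Un sets.Int sets.finite_UN) auto
  qed
  also have "\<dots> \<le> measure \<mu> (cball c r \<inter> N) + measure \<mu> (\<Union>f\<in>F. cball f \<rho>)"
    by (rule measure_Un_le) (use F(1) in \<open>auto intro!: sets.finite_UN\<close>)
  also have "measure \<mu> (\<Union>f\<in>F. cball f \<rho>) \<le> (\<Sum>f\<in>F. measure \<mu> (cball f \<rho>))"
    by (rule measure_UNION_le) (use F(1) in auto)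
  also have "\<dots> \<le> (\<Sum>f\<in>F. b * \<rho> powr \<delta>)"
    by (rule sum_mono) (use F(2) reg pos in blast)
  also have "\<dots> = real (card F) * (b * \<rho> powr \<delta>)" by simp
  also have "measure \<mu> (cball c r \<inter> N) \<le> \<theta> * (b * r powr \<delta>)"
    using decay mult_left_mono[OF _ \<theta>(1), of "measure \<mu> (cball c r)" "b * r powr \<delta>"]
      reg[OF \<open>c \<in> K\<close>, of r] pos unfolding N_def by auto
  also have "\<theta> * (b * r powr \<delta>) \<le> a / 2 * r powr \<delta>"
    using mult_right_mono[OF \<theta>(2), of "r powr \<delta>"] by (simp add: mult.assoc)
  finally have "measure \<mu> (cball c r) \<le> a / 2 * r powr \<delta> + real (card F) * (b * \<rho> powr \<delta>)"
    by simp
  then have "a / 2 * r powr \<delta> \<le> real (card F) * (b * \<rho> powr \<delta>)"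
    using reg[OF \<open>c \<in> K\<close>, of r] pos by auto
  then have "a / (2 * b) * (r / \<rho>) powr \<delta> \<le> real (card F)"
    using pos by (simp add: powr_divide field_simps)
  then show thesis using that F unfolding N_def by blast
qed

text \<open>The balls of radius \<open>r / 3\<close> around an \<open>r\<close>-separated set are disjoint, so there are only of the order
  of \<open>r powr (- \<delta>)\<close> of them, and for a maximal set the balls of radius \<open>r\<close> cover \<open>K\<close>.\<close>

lemma hausdorff_dim_le_ahlfors_regular:
  fixes K :: "'a::euclidean_space set"
  assumes "compact K" and supp: "supported_measure \<mu> K" and ahl: "ahlfors_regular \<delta> \<mu> K"
  shows "hausdorff_dim K \<le> ereal \<delta>"
proof (rule hausdorff_dim_le_if_null)
  show "0 \<le> \<delta>" using ahl by (simp add: ahlfors_regular_def)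
  fix s assume "\<delta> < s"
  interpret finite_measure \<mu> using supp by (simp add: supported_measure_def)
  have sets[simp]: "sets \<mu> = sets borel" using supp by (auto simp: supported_measure_def)
  obtain r0 a where r0: "0 < r0" "0 < a"
    and reg: "\<And>c r. c \<in> K \<Longrightarrow> 0 < r \<Longrightarrow> r < r0 \<Longrightarrow> a * r powr \<delta> \<le> measure \<mu> (cball c r)"
    using ahl unfolding ahlfors_regular_def by blast
  define M where "M = measure \<mu> (space \<mu>)"
  define C where "C = M * 3 powr \<delta> * 2 powr s / a"
  have premeasure: "hausdorff_premeasure s \<rho> K \<le> ennreal (C * r powr (s - \<delta>))"
    if r: "0 < r" "r < r0" "2 * r \<le> \<rho>" for r \<rho>
  proof -
    obtain F where F: "finite F" "F \<subseteq> K"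
      "\<And>f g. f \<in> F \<Longrightarrow> g \<in> F \<Longrightarrow> f \<noteq> g \<Longrightarrow> r < dist f g" "K \<subseteq> (\<Union>f\<in>F. cball f r)"
      by (rule maximal_separated_set[OF \<open>compact K\<close> subset_refl r(1)]) (rule that)
    have disj: "disjoint_family_on (\<lambda>f. cball f (r / 3)) F"
      unfolding disjoint_family_on_def disjoint_iff
    proof (intro ballI impI allI notI)
      fix f g x assume fg: "f \<in> F" "g \<in> F" "f \<noteq> g" and x: "x \<in> cball f (r / 3)" "x \<in> cball g (r / 3)"
      have "dist f x \<le> r / 3" "dist g x \<le> r / 3" using x by simp_all
      then show False using F(3)[OF fg] dist_triangle2[of f g x] r(1) by linarith
    qed
    have "real (card F) * (a * (r / 3) powr \<delta>) = (\<Sum>f\<in>F. a * (r / 3) powr \<delta>)" by simp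
    also have "\<dots> \<le> (\<Sum>f\<in>F. measure \<mu> (cball f (r / 3)))"
      by (rule sum_mono) (use F(2) r in \<open>auto intro!: reg\<close>)
    also have "\<dots> = measure \<mu> (\<Union>f\<in>F. cball f (r / 3))"
      using F(1) disj by (intro finite_measure_finite_Union[symmetric]) auto
    also have "\<dots> \<le> M" unfolding M_def by (rule bounded_measure)
    finally have "real (card F) \<le> M / (a * (r / 3) powr \<delta>)"
      using r0 r by (simp add: pos_le_divide_eq)
    then have "real (card F) * (2 * r) powr s \<le> M / (a * (r / 3) powr \<delta>) * (2 * r) powr s"
      by (rule mult_right_mono) simp
    also have "\<dots> = C * r powr (s - \<delta>)"
      using r r0 by (simp add: C_def powr_divide powr_mult powr_diff field_simps)
    finally have "ennreal (real (card F) * (2 * r) powr s) \<le> ennreal (C * r powr (s - \<delta>))"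
      by (rule ennreal_leI)
    then show ?thesis
      using hausdorff_premeasure_le_finite_cover[OF F(1,4) r(1,3), of s] \<open>0 \<le> \<delta>\<close> \<open>\<delta> < s\<close> by simp
  qed
  have "hausdorff_premeasure s \<rho> K = 0" if "0 < \<rho>" for \<rho>
  proof -
    have "((\<lambda>r. C * r powr (s - \<delta>)) \<longlongrightarrow> C * 0 powr (s - \<delta>)) (at_right 0)"
      by (intro tendsto_intros tendsto_powr') (use \<open>\<delta> < s\<close> in \<open>auto simp: eventually_at_right_less less_imp_le intro: eventually_mono[OF eventually_at_right_less]\<close>)
    then have "((\<lambda>r. ennreal (C * r powr (s - \<delta>))) \<longlongrightarrow> ennreal 0) (at_right 0)"
      by (intro tendsto_ennrealI) simp
    moreover have "eventually (\<lambda>r. hausdorff_premeasure s \<rho> K \<le> ennreal (C * r powr (s - \<delta>))) (at_right 0)"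
    proof -
      have "eventually (\<lambda>r. r \<in> {0<..<min r0 (\<rho> / 2)}) (at_right (0 :: real))"
        by (rule eventually_at_right_real) (use r0 that in auto)
      then show ?thesis by eventually_elim (auto intro!: premeasure)
    qed
    ultimately have "hausdorff_premeasure s \<rho> K \<le> ennreal 0"
      by (intro tendsto_lowerbound) auto
    then show ?thesis by simp
  qed
  then show "hausdorff_measure s K = 0" unfolding hausdorff_measure_def by simp
qed

text \<open>The badly approximable points are taken in the half-open cube, whereas \<open>K\<close> may touch the faces
  on which a coordinate equals \<open>1\<close>. Letting \<open>\<epsilon>\<close> tend to \<open>0\<close> in the decay condition shows that
  these faces are null sets, so \<open>K\<close> has a point off them around which to start the construction.\<close>

lemma decaying_measure_off_upper_faces:
  fixes K :: "(real ^ 'n) set"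
  assumes supp: "supported_measure \<mu> K" and decay: "absolutely_decaying \<alpha> \<mu> K"
    and ahl: "ahlfors_regular \<delta> \<mu> K"
    and cube: "K \<subseteq> {x. \<forall>i. 0 \<le> x $ i \<and> x $ i \<le> 1}"
  shows "\<exists>x\<in>K. \<forall>i. x $ i < 1"
proof (rule ccontr)
  assume no: "\<not> ?thesis"
  have faces: "\<exists>i. x $ i = 1" if x: "x \<in> K" for x
  proof -
    obtain i where "\<not> x $ i < 1" using x no by blast
    moreover have "x $ i \<le> 1" using cube x by blast
    ultimately have "x $ i = 1" by simp
    then show ?thesis ..
  qed
  interpret finite_measure \<mu> using supp by (simp add: supported_measure_def)
  have sets[simp]: "sets \<mu> = sets borel" and AE: "AE x in \<mu>. x \<in> K" and nz: "emeasure \<mu> UNIV \<noteq> 0"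
    using supp by (auto simp: supported_measure_def)
  have "K \<noteq> {}"
  proof
    assume "K = {}"
    then have "emeasure \<mu> (space \<mu>) = 0"
      using AE emeasure_eq_0_AE[of "\<lambda>_. True" \<mu>] by simp
    then show False using nz sets_eq_imp_space_eq[OF sets] by simp
  qed
  then obtain c where "c \<in> K" by blast
  obtain r1 a where r1: "0 < r1" "0 < a"
    and reg: "\<And>c r. c \<in> K \<Longrightarrow> 0 < r \<Longrightarrow> r < r1 \<Longrightarrow> a * r powr \<delta> \<le> measure \<mu> (cball c r)"
    using ahl unfolding ahlfors_regular_def by blast
  obtain C r2 where r2: "0 < r2" "0 < \<alpha>"
    and dec: "\<And>L \<epsilon> x r. affine_hyperplane L \<Longrightarrow> 0 < \<epsilon> \<Longrightarrow> x \<in> K \<Longrightarrow> 0 < r \<Longrightarrow> r < r2 \<Longrightarrow>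
      measure \<mu> (cball x r \<inter> neighbourhood L \<epsilon>) \<le> C * (\<epsilon> / r) powr \<alpha> * measure \<mu> (cball x r)"
    using decay unfolding absolutely_decaying_def by blast
  define r where "r = min r1 r2 / 2"
  have r: "0 < r" "r < r1" "r < r2" using r1 r2 by (auto simp: r_def)
  have closed_face: "closed {x :: real ^ 'n. x $ i = 1}" for i
    by (intro closed_Collect_eq continuous_intros)
  have null: "measure \<mu> (cball c r \<inter> {x. x $ i = 1}) \<le> 0" for i
  proof (rule tendsto_lowerbound)
    define m where "m = measure \<mu> (cball c r)"
    have "((\<lambda>\<epsilon>. C * (\<epsilon> / r) powr \<alpha> * m) \<longlongrightarrow> C * (0 / r) powr \<alpha> * m) (at_right 0)"
      by (intro tendsto_intros tendsto_powr')
        (use r r2 in \<open>auto intro: eventually_mono[OF eventually_at_right_less]\<close>)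
    then show "((\<lambda>\<epsilon>. C * (\<epsilon> / r) powr \<alpha> * m) \<longlongrightarrow> 0) (at_right 0)" by simp
    have "measure \<mu> (cball c r \<inter> {x. x $ i = 1}) \<le> C * (\<epsilon> / r) powr \<alpha> * m" if "0 < \<epsilon>" for \<epsilon>
    proof -
      define L where "L = {x :: real ^ 'n. axis i 1 \<bullet> x = 1}"
      have "affine_hyperplane L" unfolding L_def by (rule affine_hyperplane_inner) simp
      have "cball c r \<inter> {x. x $ i = 1} \<subseteq> cball c r \<inter> neighbourhood L \<epsilon>"
        using that by (auto simp: L_def neighbourhood_def inner_axis' intro: exI[of _ "_ :: real ^ 'n"])
      then have "measure \<mu> (cball c r \<inter> {x. x $ i = 1}) \<le> measure \<mu> (cball c r \<inter> neighbourhood L \<epsilon>)"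
        by (rule finite_measure_mono) (simp add: open_neighbourhood)
      then show ?thesis
        using dec[OF \<open>affine_hyperplane L\<close> that \<open>c \<in> K\<close>] r unfolding m_def by fastforce
    qed
    then show "\<forall>\<^sub>F \<epsilon> in at_right 0.
        measure \<mu> (cball c r \<inter> {x. x $ i = 1}) \<le> C * (\<epsilon> / r) powr \<alpha> * m"
      by (auto intro: eventually_mono[OF eventually_at_right_less])
  qed simp
  have "measure \<mu> (cball c r) \<le> measure \<mu> (\<Union>i. cball c r \<inter> {x. x $ i = 1})"
  proof (rule finite_measure_mono_AE)
    show "AE x in \<mu>. x \<in> cball c r \<longrightarrow> x \<in> (\<Union>i. cball c r \<inter> {x. x $ i = 1})"
      using AE by eventually_elim (use faces in auto)
    show "(\<Union>i. cball c r \<inter> {x. x $ i = 1}) \<in> sets \<mu>"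
      unfolding sets using closed_face by (intro sets.finite_UN sets.Int) auto
  qed
  also have "\<dots> \<le> (\<Sum>i\<in>UNIV. measure \<mu> (cball c r \<inter> {x. x $ i = 1}))"
    by (rule measure_UNION_le) (use closed_face in \<open>auto intro!: sets.Int\<close>)
  also have "\<dots> \<le> 0" by (rule sum_nonpos) (rule null)
  finally show False using reg[OF \<open>c \<in> K\<close> r(1,2)] r r1 by (smt (verit) mult_pos_pos powr_gt_zero)
qed

section \<open>The dimension of the badly approximable points\<close>

text \<open>The two requirements on the base \<open>R\<close> of the Cantor construction. In the first, \<open>6 / R\<close> is the
  thickness of the strip to be removed, relative to the radius within which children are chosen; in the second, \<open>R / 6\<close> is the ratio of
  this radius to their separation. The exponent \<open>t < \<delta>\<close> absorbs the
  constants.\<close>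

lemma large_base_exists:
  fixes a b C t \<alpha> \<delta> :: real
  assumes "0 < a" "0 < b" "0 < \<alpha>" "t < \<delta>"
  obtains R :: nat where "2 \<le> R" and "C * (6 / real R) powr \<alpha> * b \<le> a / 2"
    and "real R powr t \<le> a / (2 * b) * (real R / 6) powr \<delta>"
proof -
  have "((\<lambda>R. C * (6 / real R) powr \<alpha> * b) \<longlongrightarrow> C * 0 powr \<alpha> * b) sequentially"
    by (intro tendsto_intros tendsto_powr' lim_const_over_n) (use assms in auto)
  then have 1: "\<forall>\<^sub>F R in sequentially. C * (6 / real R) powr \<alpha> * b < a / 2"
    by (rule order_tendstoD) (use assms in auto)
  have "((\<lambda>R. 2 * b * 6 powr \<delta> / a * real R powr (t - \<delta>)) \<longlongrightarrow> 2 * b * 6 powr \<delta> / a * 0) sequentially"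
    by (intro tendsto_intros tendsto_neg_powr filterlim_real_sequentially) (use assms in auto)
  then have 2: "\<forall>\<^sub>F R in sequentially. 2 * b * 6 powr \<delta> / a * real R powr (t - \<delta>) < 1"
    by (rule order_tendstoD) simp
  have "\<forall>\<^sub>F R in sequentially. 2 \<le> R \<and> C * (6 / real R) powr \<alpha> * b \<le> a / 2
      \<and> real R powr t \<le> a / (2 * b) * (real R / 6) powr \<delta>"
    using 1 2 eventually_ge_at_top[of 2]
  proof eventually_elim
    case (elim R)
    have "2 * b * 6 powr \<delta> / a * real R powr (t - \<delta>) * real R powr \<delta> \<le> 1 * real R powr \<delta>"
      using elim by (intro mult_right_mono) auto
    moreover have "real R powr t = real R powr (t - \<delta>) * real R powr \<delta>"
      by (simp add: powr_add[symmetric])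
    ultimately have "2 * b * 6 powr \<delta> / a * real R powr t \<le> real R powr \<delta>"
      by (simp add: mult.assoc)
    then have "real R powr t \<le> a / (2 * b) * (real R / 6) powr \<delta>"
      using assms by (simp add: powr_divide field_simps)
    then show ?case using elim by simp
  qed
  then show thesis using that by (auto simp: eventually_sequentially)
qed

text \<open>The balls of level \<open>s\<close> have radius \<open>\<kappa> / R ^ s\<close> and centres in \<open>K\<close>, and on a ball of level \<open>s + 1\<close> the
  distance of \<open>z s \<bullet> x\<close> to the integers is at least \<open>\<gamma> = \<kappa> / R\<^sup>2\<close>. The set where this fails is a union
  of strips around parallel hyperplanes, of half-width less than the radius of a ball of level \<open>s + 1\<close>
  (as \<open>norm (z s) > R ^ (s - 1)\<close>) and with gaps larger than a ball of level \<open>s\<close> (as \<open>norm (z s)\<close> is at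
  most \<open>sqrt n * R ^ s\<close>). So a ball of level \<open>s\<close> meets at most one strip, and many separated balls
  of level \<open>s + 1\<close> remain after its removal.\<close>

lemma hausdorff_dim_Bad_ge:
  fixes K :: "(real ^ 'n) set" and A :: "real ^ 'm ^ 'n"
  assumes "compact K"
    and cube: "K \<subseteq> {x. \<forall>i. 0 \<le> x $ i \<and> x $ i \<le> 1}"
    and supp: "supported_measure \<mu> K"
    and decay: "absolutely_decaying \<alpha> \<mu> K"
    and ahl: "ahlfors_regular \<delta> \<mu> K"
    and t: "0 < t" "t < \<delta>"
  shows "ereal t \<le> hausdorff_dim (Bad A \<inter> K)"
proof -
  obtain r1 a b where r1: "0 < r1" "0 < a" "1 \<le> b"
    and reg: "\<And>c r. c \<in> K \<Longrightarrow> 0 < r \<Longrightarrow> r < r1 \<Longrightarrow>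
      a * r powr \<delta> \<le> measure \<mu> (cball c r) \<and> measure \<mu> (cball c r) \<le> b * r powr \<delta>"
    using ahl unfolding ahlfors_regular_def by blast
  obtain C r2 where r2: "0 < C" "0 < r2" "0 < \<alpha>"
    and dec: "\<And>L \<epsilon> x r. affine_hyperplane L \<Longrightarrow> 0 < \<epsilon> \<Longrightarrow> x \<in> K \<Longrightarrow> 0 < r \<Longrightarrow> r < r2 \<Longrightarrow>
      measure \<mu> (cball x r \<inter> neighbourhood L \<epsilon>) \<le> C * (\<epsilon> / r) powr \<alpha> * measure \<mu> (cball x r)"
    using decay unfolding absolutely_decaying_def by blast
  have "0 < b" using r1 by simp
  obtain R :: nat where R: "2 \<le> R" "C * (6 / real R) powr \<alpha> * b \<le> a / 2"
    "real R powr t \<le> a / (2 * b) * (real R / 6) powr \<delta>"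
    using large_base_exists[OF r1(2) \<open>0 < b\<close> r2(3) t(2)] by blast
  obtain z :: "nat \<Rightarrow> real ^ 'n" where z: "\<And>s. z s \<in> int_vectors"
    "\<And>s. real R ^ s / real R < infnorm (z s)" "\<And>s. infnorm (z s) \<le> real R ^ s"
    and z_small: "\<And>t. \<exists>s\<le>t. dist_int (transpose A *v z s)
      \<le> 2 / (real R ^ t) powr (real CARD('n) / real CARD('m))"
    using lacunary_integer_directions[OF R(1), of A] by blast
  obtain x0 where x0: "x0 \<in> K" "\<And>i. x0 $ i < 1"
    using decaying_measure_off_upper_faces[OF supp decay ahl cube] by blast
  define n where "n = real CARD('n)"
  have n: "1 \<le> n" by (simp add: n_def Suc_leI)
  \<comment> \<open>A ball around \<open>x0\<close> of radius less than \<open>gap\<close> stays off the faces where a coordinate is \<open>1\<close>.\<close>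
  define gap where "gap = Min (range (\<lambda>i. 1 - x0 $ i))"
  have gap: "0 < gap" "\<And>i. gap \<le> 1 - x0 $ i" using x0(2) by (auto simp: gap_def)
  \<comment> \<open>The bounds by \<open>r1\<close> and \<open>r2\<close> keep all radii in the range of the regularity and decay conditions;
    the one by \<open>sqrt n\<close> keeps \<open>z s \<bullet> x\<close> within \<open>1 / 8\<close> of its value at the centre on each ball of level \<open>s\<close>.\<close>
  define \<kappa> where "\<kappa> = Min {r1 / 4, r2 / 4, 1 / (8 * sqrt n), gap / 2}"
  have \<kappa>: "0 < \<kappa>" "\<kappa> \<le> r1 / 4" "\<kappa> \<le> r2 / 4" "\<kappa> \<le> 1 / (8 * sqrt n)" "\<kappa> < gap"
    using r1 r2 n gap(1) by (auto simp: \<kappa>_def min_less_iff_disj)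
  have sqrt_n: "sqrt n * \<kappa> \<le> 1 / 8" using \<kappa>(4) n by (simp add: field_simps)
  have "1 \<le> sqrt n" using n by simp
  then have \<kappa>8: "\<kappa> \<le> 1 / 8" using sqrt_n mult_right_mono[of 1 "sqrt n" \<kappa>] \<kappa>(1) by linarith
  define \<gamma> where "\<gamma> = \<kappa> / (real R)\<^sup>2"
  have R_pos: "0 < real R" "1 < real R" "2 \<le> real R" using R(1) by auto
  have "\<gamma> \<le> \<kappa> / 1"
    unfolding \<gamma>_def using \<kappa>(1) R_pos by (intro divide_left_mono) (auto simp: one_le_power)
  then have "\<gamma> \<le> 1 / 8" using \<kappa>8 by simp
  moreover have "0 < \<gamma>" using \<kappa>(1) R_pos by (simp add: \<gamma>_def)
  ultimately have \<gamma>: "0 < \<gamma>" "\<gamma> \<le> 1 / 8" by simp_all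
  define P where "P s c \<longleftrightarrow> c \<in> K \<and> cball c (\<kappa> / real R ^ s) \<subseteq> cball x0 \<kappa> \<and>
    (\<forall>s'. s = Suc s' \<longrightarrow> (\<forall>x\<in>cball c (\<kappa> / real R ^ s). \<forall>p\<in>\<int>. \<gamma> \<le> \<bar>z s' \<bullet> x - p\<bar>))" for s c
  show ?thesis
  proof (rule hausdorff_dim_ge_nested_cballs[where P = P and R = "real R" and \<kappa> = \<kappa> and ?x0.0 = x0])
    show "P 0 x0" using x0 by (simp add: P_def)
  next
    fix s c assume P: "P s c"
    define r where "r = \<kappa> / real R ^ s / 2"
    define r' where "r' = \<kappa> / real R ^ Suc s"
    have "\<kappa> / real R ^ s \<le> \<kappa> / 1"
      using \<kappa>(1) R_pos by (intro divide_left_mono) (auto simp: one_le_power)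
    then have r: "0 < r" "r < r1" "r < r2" "2 * r = \<kappa> / real R ^ s"
      using \<kappa> R_pos r1 r2 by (auto simp: r_def)
    have "2 * r / real R \<le> 2 * r / 2" using R_pos r(1) by (intro divide_left_mono) auto
    moreover have r'_eq: "r' = 2 * r / real R" by (simp add: r'_def r_def)
    ultimately have r': "0 < r'" "r' \<le> r" "3 * r' < r1"
      using \<kappa> R_pos r \<open>\<kappa> / real R ^ s \<le> \<kappa> / 1\<close> r1 by auto
    have ratio: "3 * r' / r = 6 / real R" "r / (3 * r') = real R / 6"
      using r r' R_pos by (simp_all add: r'_eq field_simps)
    have norm_z: "real R ^ s / real R < norm (z s)" "norm (z s) \<le> sqrt n * real R ^ s"
    proof -
      show "real R ^ s / real R < norm (z s)" using z(2)[of s] infnorm_le_norm[of "z s"] by simp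
      have "norm (z s) \<le> sqrt n * infnorm (z s)" using norm_le_infnorm[of "z s"] by (simp add: n_def)
      also have "\<dots> \<le> sqrt n * real R ^ s" using z(3)[of s] n by (intro mult_left_mono) auto
      finally show "norm (z s) \<le> sqrt n * real R ^ s" .
    qed
    then have "z s \<noteq> 0" using R_pos by (metis divide_pos_pos less_asym norm_zero zero_less_power)
    \<comment> \<open>The only hyperplane that matters belongs to the integer nearest to the value at the centre.
      Centres are chosen within half the radius, to leave room for the child balls, and at distance
      \<open>3 * r'\<close> from \<open>L\<close>, so that the child balls miss the strip of half-width \<open>r'\<close>.\<close>
    define L where "L = {y. z s \<bullet> y = of_int (round (z s \<bullet> c))}"
    have "c \<in> K" using P by (simp add: P_def)
    have L: "affine_hyperplane L" unfolding L_def by (rule affine_hyperplane_inner[OF \<open>z s \<noteq> 0\<close>])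
    obtain F where F: "finite F" "F \<subseteq> K \<inter> cball c r - neighbourhood L (3 * r')"
      "\<And>f g. f \<in> F \<Longrightarrow> g \<in> F \<Longrightarrow> f \<noteq> g \<Longrightarrow> 3 * r' < dist f g"
      "a / (2 * b) * (r / (3 * r')) powr \<delta> \<le> real (card F)"
    proof (rule many_separated_points_off_hyperplane[OF \<open>compact K\<close> supp reg r1(2) \<open>0 < b\<close> _ r'(3) r(1,2)])
      show "measure \<mu> (cball c r \<inter> neighbourhood L (3 * r'))
          \<le> C * (6 / real R) powr \<alpha> * measure \<mu> (cball c r)"
        using dec[OF L, of "3 * r'" c r] r r' \<open>c \<in> K\<close> unfolding ratio by simp
      show "0 \<le> C * (6 / real R) powr \<alpha>" using r2 by simp
    qed (use R \<open>c \<in> K\<close> r' in auto)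
    have inside: "cball f r' \<subseteq> cball c (2 * r)" if "f \<in> F" for f
    proof
      fix x assume "x \<in> cball f r'"
      moreover have "dist c f \<le> r" using F(2) that by auto
      ultimately show "x \<in> cball c (2 * r)" using dist_triangle[of c x f] r'(2) by simp
    qed
    have avoid: "\<gamma> \<le> \<bar>z s \<bullet> x - p\<bar>" if f: "f \<in> F" and x: "x \<in> cball f r'" and p: "p \<in> \<int>" for f x p
    proof (rule ccontr)
      assume "\<not> \<gamma> \<le> \<bar>z s \<bullet> x - p\<bar>"
      then have near: "\<bar>z s \<bullet> x - p\<bar> < \<gamma>" by simp
      obtain k where k: "p = of_int k" using p by (rule Ints_cases)
      \<comment> \<open>The ball is too small to meet strips around two distinct hyperplanes.\<close>
      have "\<bar>z s \<bullet> (x - c)\<bar> \<le> norm (z s) * norm (x - c)" by (rule Cauchy_Schwarz_ineq2)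
      also have "\<dots> \<le> (sqrt n * real R ^ s) * (\<kappa> / real R ^ s)"
        using inside[OF f] x norm_z(2) n R_pos r(4)
        by (intro mult_mono) (auto simp: dist_norm norm_minus_commute)
      also have "\<dots> \<le> 1 / 8" using sqrt_n R_pos by simp
      finally have "\<bar>z s \<bullet> c - of_int k\<bar> < 1 / 2"
        using near \<gamma>(2) unfolding k inner_diff_right by linarith
      then have "round (z s \<bullet> c) = k" by (intro round_unique') (simp add: abs_minus_commute)
      moreover have "\<gamma> \<le> r' * norm (z s)"
      proof -
        have "\<gamma> = r' * (real R ^ s / real R)"
          using R_pos by (simp add: \<gamma>_def r'_def power2_eq_square)
        also have "\<dots> \<le> r' * norm (z s)" using norm_z(1) r'(1) by (intro mult_left_mono) auto
        finally show ?thesis .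
      qed
      ultimately have "x \<in> neighbourhood L r'"
        unfolding L_def using near k \<open>z s \<noteq> 0\<close> by (intro in_neighbourhood_hyperplane) auto
      then obtain y where "y \<in> L" "dist x y < r'" by (auto simp: neighbourhood_def)
      moreover have "dist f y < 3 * r'"
        using x \<open>dist x y < r'\<close> dist_triangle[of f y x] r'(1) by simp
      ultimately have "f \<in> neighbourhood L (3 * r')" by (auto simp: neighbourhood_def)
      then show False using F(2) f by blast
    qed
    have "P (Suc s) f \<and> cball f (\<kappa> / real R ^ Suc s) \<subseteq> cball c (\<kappa> / real R ^ s)" if "f \<in> F" for f
      using avoid[OF that] inside[OF that] F(2) that P unfolding P_def r'_def[symmetric] r(4)
      by (auto simp del: mem_cball)
    moreover have "real R powr t \<le> real (card F)" using R(3) F(4) unfolding ratio by simp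
    ultimately show "\<exists>F. finite F \<and> real R powr t \<le> real (card F) \<and>
        (\<forall>f\<in>F. P (Suc s) f \<and> cball f (\<kappa> / real R ^ Suc s) \<subseteq> cball c (\<kappa> / real R ^ s)) \<and>
        (\<forall>f\<in>F. \<forall>g\<in>F. f \<noteq> g \<longrightarrow> 3 * (\<kappa> / real R ^ Suc s) < dist f g)"
      using F(1,3) unfolding r'_def by blast
  next
    fix xs x assume P: "\<And>s. P s (xs s)" and x: "\<And>s. x \<in> cball (xs s) (\<kappa> / real R ^ s)"
    have "xs \<longlonglongrightarrow> x"
    proof (rule metric_tendsto_imp_tendsto[of "\<lambda>s. \<kappa> / real R ^ s" 0])
      show "(\<lambda>s. \<kappa> / real R ^ s) \<longlonglongrightarrow> 0" by (rule LIMSEQ_divide_realpow_zero[OF R_pos(2)])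
      show "\<forall>\<^sub>F s in sequentially. dist (xs s) x \<le> dist (\<kappa> / real R ^ s) 0"
        using x \<kappa>(1) by (auto simp: abs_of_pos)
    qed
    then have "x \<in> K"
      using closed_sequentially[OF compact_imp_closed[OF \<open>compact K\<close>]] P by (auto simp: P_def)
    moreover have "x \<in> Bad A"
    proof (rule lacunary_directions_imp_Bad[OF R(1) z(1) z(3) z_small])
      fix i
      have "x \<in> cball x0 \<kappa>" using P[of 0] x[of 0] by (auto simp: P_def)
      then have "\<bar>x $ i - x0 $ i\<bar> \<le> \<kappa>"
        using component_le_norm_cart[of "x - x0" i] by (simp add: dist_norm norm_minus_commute)
      then show "0 \<le> x $ i \<and> x $ i < 1" using \<open>x \<in> K\<close> cube gap(2)[of i] \<kappa>(5) by force
    next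
      fix s and p :: real assume "p \<in> \<int>"
      then show "\<gamma> \<le> \<bar>z s \<bullet> x - p\<bar>" using P[of "Suc s"] x[of "Suc s"] by (simp add: P_def del: mem_cball)
    qed (use \<gamma> in auto)
    ultimately show "x \<in> Bad A \<inter> K" by blast
  qed (use \<kappa> R_pos t in auto)
qed

theorem theorem2:
  fixes K :: "(real ^ 'n) set"
    and \<mu> :: "(real ^ 'n) measure"
    and A :: "real ^ 'm ^ 'n"
    and \<alpha> \<delta> :: real
  assumes "compact K"
    and "K \<subseteq> {x. \<forall>i. 0 \<le> x $ i \<and> x $ i \<le> 1}"
    and "supported_measure \<mu> K"
    and "absolutely_decaying \<alpha> \<mu> K"
    and "ahlfors_regular \<delta> \<mu> K"
    and "\<delta> > real CARD('n) - 1"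
  shows "hausdorff_dim (Bad A \<inter> K) = ereal \<delta>"
proof (rule antisym)
  have "hausdorff_dim (Bad A \<inter> K) \<le> hausdorff_dim K" by (rule hausdorff_dim_mono) simp
  also have "\<dots> \<le> ereal \<delta>" using assms by (intro hausdorff_dim_le_ahlfors_regular)
  finally show "hausdorff_dim (Bad A \<inter> K) \<le> ereal \<delta>" .
  have "0 < \<delta>" using assms by (simp add: ahlfors_regular_def)
  show "ereal \<delta> \<le> hausdorff_dim (Bad A \<inter> K)"
  proof (rule dense_le_bounded)
    show "ereal 0 < ereal \<delta>" using \<open>0 < \<delta>\<close> by simp
    fix w assume w: "ereal 0 < w" "w < ereal \<delta>"
    then obtain t where "w = ereal t" by (cases w) auto
    then show "w \<le> hausdorff_dim (Bad A \<inter> K)"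
      using hausdorff_dim_Bad_ge[OF assms(1-5), of t A] w by simp
  qed
qed

end
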